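(* Let $o\in\mathbb{H}^{p,q-1}$, $\tau\in S^o$, and let $\mathfrak{b}^+$ be a closed Weyl chamber of a maximal subalgebra $\mathfrak{b}\subset\mathfrak{p}^\tau\cap\mathfrak{q}^o$. For every $g\in\mathscr{C}^>_{o,G}$ one can write $$g=h\exp(X)h'$$ for some $h,h'\in H^o$ and a unique $X\in\mathfrak{b}^+$.
   Context: Fix integers $p,q\ge1$ with $d:=p+q>2$. On $\mathbb{R}^d$ let $\langle x,y\rangle_{p,q}:=\sum_{i=1}^p x_iy_i-\sum_{i=p+1}^d x_iy_i$, with orthogonal complements denoted $\cdot^{\perp_{p,q}}$. $G:=\mathrm{PSO}(p,q)\subset\mathrm{PSL}(d,\mathbb{R})$ is the group of projectivized matrices of $\mathrm{SL}(d,\mathbb{R})$ preserving the form, with Lie algebra $\mathfrak{g}=\mathfrak{so}(p,q)$. $\mathbb{H}^{p,q-1}:=\{o=[\hat o]\in\mathbb{P}(\mathbb{R}^d):\langle\hat o,\hat o\rangle_{p,q}<0\}$. Its space-like geodesics are the intersections with $\mathbb{H}^{p,q-1}$ of projectivized $2$-planes on which the form has signature $(1,1)$. For $o\in\mathbb{H}^{p,q-1}$, $\mathscr{C}^>_o$ is the set of points of $\mathbb{H}^{p,q-1}$ that can be joined to $o$ by a space-like geodesic and $\mathscr{C}^>_{o,G}:=\{g\in G:g\cdot o\in\mathscr{C}^>_o\}$. Let $J^o:=\mathrm{id}_o\oplus(-\mathrm{id}_{o^{\perp_{p,q}}})$, $H^o$ the stabilizer of $o$ in $G$, $\mathfrak{q}^o:=\{X\in\mathfrak{g}:J^oXJ^o=-X\}$.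 $X_G$ is the space of $q$-dimensional negative definite subspaces $\tau$ of $\mathbb{R}^d$; $S^o:=\{\tau\in X_G:o\subset\tau\}$. For $\tau\in X_G$, $\langle\cdot,\cdot\rangle_\tau$ is the inner product equal to $-\langle\cdot,\cdot\rangle_{p,q}$ on $\tau$, to $\langle\cdot,\cdot\rangle_{p,q}$ on $\tau^{\perp_{p,q}}$ and making these orthogonal; $\mathfrak{p}^\tau$ is the set of $X\in\mathfrak{g}$ symmetric for $\langle\cdot,\cdot\rangle_\tau$. For $\tau\in S^o$, a maximal subalgebra $\mathfrak{b}\subset\mathfrak{p}^\tau\cap\mathfrak{q}^o$ is abelian and one-dimensional; a closed Weyl chamber $\mathfrak{b}^+$ is a closed half-line of $\mathfrak{b}$ starting at $0$. *)

theory Defs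
  imports "HOL-Analysis.Analysis" "HOL-Algebra.Coset"
begin

text \<open>The form of signature \<open>(p, q)\<close> lives on \<open>real ^ ('p + 'q)\<close>, with
  \<open>p = CARD('p)\<close> and \<open>q = CARD('q)\<close>; both are at least 1 because types are nonempty. Points of
  projective space are one-dimensional subspaces, that is \<open>[v] = span {v}\<close>.\<close>

definition pq_form :: "real ^ ('p::finite + 'q::finite) \<Rightarrow> real ^ ('p + 'q) \<Rightarrow> real" where
  "pq_form x y =
     (\<Sum>i\<in>(UNIV :: 'p set). x $ Inl i * y $ Inl i) - (\<Sum>j\<in>(UNIV :: 'q set). x $ Inr j * y $ Inr j)"

definition pq_perp :: "(real ^ ('p::finite + 'q::finite)) set \<Rightarrow> (real ^ ('p + 'q)) set" where
  "pq_perp W = {x. \<forall>w\<in>W. pq_form x w = 0}"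

definition pos_definite_on :: "(real ^ ('p::finite + 'q::finite)) set \<Rightarrow> bool" where
  "pos_definite_on W \<longleftrightarrow> (\<forall>x\<in>W. x \<noteq> 0 \<longrightarrow> pq_form x x > 0)"

definition neg_definite_on :: "(real ^ ('p::finite + 'q::finite)) set \<Rightarrow> bool" where
  "neg_definite_on W \<longleftrightarrow> (\<forall>x\<in>W. x \<noteq> 0 \<longrightarrow> pq_form x x < 0)"

text \<open>The restriction of the form to \<open>V\<close> has signature \<open>(a, b)\<close>. Since \<open>dim V = a + b\<close>, the
  restriction is nondegenerate and \<open>V\<close> is the orthogonal direct sum of \<open>P\<close> and \<open>N\<close>.\<close>

definition has_signature :: "(real ^ ('p::finite + 'q::finite)) set \<Rightarrow> nat \<Rightarrow> nat \<Rightarrow> bool" where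
  "has_signature V a b \<longleftrightarrow> subspace V \<and> dim V = a + b \<and>
     (\<exists>P N. subspace P \<and> P \<subseteq> V \<and> dim P = a \<and> pos_definite_on P \<and>
            subspace N \<and> N \<subseteq> V \<and> dim N = b \<and> neg_definite_on N \<and>
            (\<forall>x\<in>P. \<forall>y\<in>N. pq_form x y = 0))"


text \<open>The special linear group, and its quotient by the scalar matrices it contains.\<close>

definition SL :: "(real ^ 'n::finite ^ 'n) monoid" where
  "SL = \<lparr>carrier = {A. det A = 1}, monoid.mult = (**), one = mat 1\<rparr>"

definition SL_scalars :: "(real ^ 'n::finite ^ 'n) set" where
  "SL_scalars = {A \<in> carrier SL. \<exists>c. A = c *\<^sub>R mat 1}"

definition PSL :: "(real ^ 'n::finite ^ 'n) set monoid" where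
  "PSL = SL Mod SL_scalars"

definition proj_class :: "real ^ 'n::finite ^ 'n \<Rightarrow> (real ^ 'n ^ 'n) set" where
  "proj_class A = SL_scalars #>\<^bsub>SL\<^esub> A"

definition PSO :: "(real ^ ('p::finite + 'q::finite) ^ ('p + 'q)) set monoid" where
  "PSO = PSL\<lparr>carrier :=
     {proj_class A | A. A \<in> carrier SL \<and> (\<forall>x y. pq_form (A *v x) (A *v y) = pq_form x y)}\<rparr>"

text \<open>The image of a projective point under a class of matrices: all representatives give the same
  image, so the union is just that image.\<close>

definition proj_act :: "(real ^ 'n::finite ^ 'n) set \<Rightarrow> (real ^ 'n) set \<Rightarrow> (real ^ 'n) set" where
  "proj_act g pt = (\<Union>A\<in>g. (\<lambda>x. A *v x) ` pt)"


definition Hpq :: "(real ^ ('p::finite + 'q::finite)) set set" where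
  "Hpq = {span {v} | v. pq_form v v < 0}"

definition spacelike_geodesics :: "(real ^ ('p::finite + 'q::finite)) set set set" where
  "spacelike_geodesics = {{x \<in> Hpq. x \<subseteq> V} | V. has_signature V 1 1}"

text \<open>The points lying on a common space-like geodesic with \<open>pt\<close>; \<open>pt\<close> itself is one of them.\<close>

definition C_spacelike :: "(real ^ ('p::finite + 'q::finite)) set \<Rightarrow> (real ^ ('p + 'q)) set set" where
  "C_spacelike pt = {x \<in> Hpq. \<exists>\<gamma>\<in>spacelike_geodesics. pt \<in> \<gamma> \<and> x \<in> \<gamma>}"

definition C_spacelike_G ::
  "(real ^ ('p::finite + 'q::finite)) set \<Rightarrow> (real ^ ('p + 'q) ^ ('p + 'q)) set set" where
  "C_spacelike_G pt = {g \<in> carrier PSO. proj_act g pt \<in> C_spacelike pt}"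

definition stabilizer_pt ::
  "(real ^ ('p::finite + 'q::finite)) set \<Rightarrow> (real ^ ('p + 'q) ^ ('p + 'q)) set set" where
  "stabilizer_pt pt = {g \<in> carrier PSO. proj_act g pt = pt}"


definition so_pq :: "(real ^ ('p::finite + 'q::finite) ^ ('p + 'q)) set" where
  "so_pq = {X. \<forall>x y. pq_form (X *v x) y + pq_form x (X *v y) = 0}"

definition J_pt ::
  "(real ^ ('p::finite + 'q::finite)) set \<Rightarrow> real ^ ('p + 'q) ^ ('p + 'q)" where
  "J_pt pt = (THE J. (\<forall>x\<in>pt. J *v x = x) \<and> (\<forall>x\<in>pq_perp pt. J *v x = - x))"

definition q_part ::
  "(real ^ ('p::finite + 'q::finite)) set \<Rightarrow> (real ^ ('p + 'q) ^ ('p + 'q)) set" where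
  "q_part pt = {X \<in> so_pq. J_pt pt ** X ** J_pt pt = - X}"

definition X_G :: "(real ^ ('p::finite + 'q::finite)) set set" where
  "X_G = {\<tau>. subspace \<tau> \<and> dim \<tau> = CARD('q) \<and> neg_definite_on \<tau>}"

definition S_pt :: "(real ^ ('p::finite + 'q::finite)) set \<Rightarrow> (real ^ ('p + 'q)) set set" where
  "S_pt pt = {\<tau> \<in> X_G. pt \<subseteq> \<tau>}"

definition tau_inner ::
  "(real ^ ('p::finite + 'q::finite)) set \<Rightarrow> real ^ ('p + 'q) \<Rightarrow> real ^ ('p + 'q) \<Rightarrow> real" where
  "tau_inner \<tau> = (THE K. bilinear K \<and>
     (\<forall>x\<in>\<tau>. \<forall>y\<in>\<tau>. K x y = - pq_form x y) \<and>
     (\<forall>x\<in>pq_perp \<tau>. \<forall>y\<in>pq_perp \<tau>. K x y = pq_form x y) \<and>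
     (\<forall>x\<in>\<tau>. \<forall>y\<in>pq_perp \<tau>. K x y = 0 \<and> K y x = 0))"

definition p_part ::
  "(real ^ ('p::finite + 'q::finite)) set \<Rightarrow> (real ^ ('p + 'q) ^ ('p + 'q)) set" where
  "p_part \<tau> = {X \<in> so_pq. \<forall>x y. tau_inner \<tau> (X *v x) y = tau_inner \<tau> x (X *v y)}"

definition lie_subalgebra :: "(real ^ 'n::finite ^ 'n) set \<Rightarrow> bool" where
  "lie_subalgebra \<bb> \<longleftrightarrow> subspace \<bb> \<and> (\<forall>X\<in>\<bb>. \<forall>Y\<in>\<bb>. X ** Y - Y ** X \<in> \<bb>)"

definition maximal_subalgebra_in ::
  "(real ^ 'n::finite ^ 'n) set \<Rightarrow> (real ^ 'n ^ 'n) set \<Rightarrow> bool" where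
  "maximal_subalgebra_in E \<bb> \<longleftrightarrow> lie_subalgebra \<bb> \<and> \<bb> \<subseteq> E \<and>
     (\<forall>\<cc>. lie_subalgebra \<cc> \<longrightarrow> \<cc> \<subseteq> E \<longrightarrow> \<bb> \<subseteq> \<cc> \<longrightarrow> \<cc> = \<bb>)"

text \<open>Closed half-lines issued from 0; these are the closed Weyl chambers when \<open>dim \<bb> = 1\<close>.\<close>

definition closed_weyl_chamber ::
  "(real ^ 'n::finite ^ 'n) set \<Rightarrow> (real ^ 'n ^ 'n) set \<Rightarrow> bool" where
  "closed_weyl_chamber \<bb> C \<longleftrightarrow> (\<exists>X\<in>\<bb>. X \<noteq> 0 \<and> C = {t *\<^sub>R X | t. 0 \<le> t})"

text \<open>The library's \<open>exp\<close> is not available for the matrix product on \<open>real ^ 'n ^ 'n\<close>.\<close>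

definition matrix_exp :: "real ^ 'n::finite ^ 'n \<Rightarrow> real ^ 'n ^ 'n" where
  "matrix_exp X = (\<Sum>k. (1 / fact k) *\<^sub>R (((**) X ^^ k) (mat 1)))"

end

theory Submission
  imports Defs
begin

text \<open>Normalize \<open>o = [v]\<close> with \<open>\<langle>v, v\<rangle> = - 1\<close>. An element \<open>X \<noteq> 0\<close> of \<open>\<pp>\<^sup>\<tau> \<inter> \<qq>\<^sup>o\<close> is determined by
  \<open>X v\<close>, which lies in the positive definite space \<open>\<tau>\<^sup>\<bottom>\<close>; so \<open>X v = s w\<close> with \<open>\<langle>w, w\<rangle> = 1\<close>, and
  \<open>exp (t X)\<close> is the hyperbolic boost of parameter \<open>t s\<close> in the plane of \<open>v\<close> and \<open>w\<close>. If \<open>A v\<close> lies on a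
  space-like geodesic through \<open>o\<close>, then up to sign \<open>A v = cosh c v + sinh c u\<close> with \<open>c \<ge> 0\<close> and \<open>u\<close>
  unit and orthogonal to \<open>v\<close>. As \<open>d > 2\<close>, a product \<open>H\<close> of two reflections fixes \<open>v\<close> and maps \<open>w\<close>
  to \<open>u\<close>, so that \<open>(H exp (t X))\<^sup>-\<^sup>1 A\<close> stabilizes \<open>o\<close> for \<open>t = c / s\<close>. The parameter is unique because
  \<open>cosh (t s) = |\<langle>A v, v\<rangle>|\<close>.\<close>

section \<open>The form of signature (p, q)\<close>

text \<open>The Gram operator of the form for the Euclidean inner product; through it, Euclidean
  facts about complements and rank one matrices apply to \<open>pq_form\<close>.\<close>

definition pq_flip :: "real ^ ('p::finite + 'q::finite) \<Rightarrow> real ^ ('p + 'q)" where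
  "pq_flip x = (\<chi> i. case i of Inl a \<Rightarrow> x $ Inl a | Inr b \<Rightarrow> - x $ Inr b)"

lemma pq_form_eq_inner: "pq_form x y = x \<bullet> pq_flip y"
proof -
  have "x \<bullet> pq_flip y = (\<Sum>i\<in>UNIV <+> UNIV. x $ i * pq_flip y $ i)"
    by (simp add: inner_vec_def)
  also have "\<dots> = pq_form x y"
    by (subst sum.Plus) (auto simp: pq_form_def pq_flip_def sum_negf)
  finally show ?thesis by simp
qed

lemma pq_flip_flip [simp]: "pq_flip (pq_flip x) = x"
  by (simp add: pq_flip_def vec_eq_iff split: sum.split)

lemma linear_pq_flip: "linear pq_flip"
  by (rule linearI) (auto simp: pq_flip_def vec_eq_iff split: sum.split)

lemma pq_form_sym: "pq_form x y = pq_form y x"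
  by (simp add: pq_form_def mult.commute)

lemma bilinear_pq_form: "bilinear pq_form"
  unfolding bilinear_def pq_form_def
  by (auto intro!: linearI simp: algebra_simps sum.distrib sum_subtractf sum_distrib_left)

lemma pq_form_add_left [simp]: "pq_form (x + y) z = pq_form x z + pq_form y z"
  and pq_form_add_right [simp]: "pq_form z (x + y) = pq_form z x + pq_form z y"
  and pq_form_diff_left [simp]: "pq_form (x - y) z = pq_form x z - pq_form y z"
  and pq_form_diff_right [simp]: "pq_form z (x - y) = pq_form z x - pq_form z y"
  and pq_form_minus_left [simp]: "pq_form (- x) z = - pq_form x z"
  and pq_form_minus_right [simp]: "pq_form z (- x) = - pq_form z x"
  and pq_form_scaleR_left [simp]: "pq_form (c *\<^sub>R x) z = c * pq_form x z"
  and pq_form_scaleR_right [simp]: "pq_form z (c *\<^sub>R x) = c * pq_form z x"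
  and pq_form_zero_left [simp]: "pq_form 0 z = 0"
  and pq_form_zero_right [simp]: "pq_form z 0 = 0"
  using bilinear_ladd[OF bilinear_pq_form, of x y z] bilinear_radd[OF bilinear_pq_form, of z x y]
    bilinear_lsub[OF bilinear_pq_form, of x y z] bilinear_rsub[OF bilinear_pq_form, of z x y]
    bilinear_lneg[OF bilinear_pq_form, of x z] bilinear_rneg[OF bilinear_pq_form, of z x]
    bilinear_lmul[OF bilinear_pq_form, of c x z] bilinear_rmul[OF bilinear_pq_form, of z c x]
    bilinear_lzero[OF bilinear_pq_form, of z] bilinear_rzero[OF bilinear_pq_form, of z]
  by simp_all

lemma pq_form_nondegenerate:
  assumes "\<And>y. pq_form x y = 0"
  shows "x = 0"
  using assms[of "pq_flip x"] by (simp add: pq_form_eq_inner)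

lemma subspace_pq_perp: "subspace (pq_perp W)"
  by (auto simp: subspace_def pq_perp_def)

text \<open>\<open>pq_perp W\<close> is the Euclidean complement of the image of \<open>W\<close>
  under the injective map \<open>pq_flip\<close>, so the count also holds when the form degenerates
  on \<open>W\<close>.\<close>

lemma dim_pq_perp:
  fixes W :: "(real ^ ('p::finite + 'q::finite)) set"
  assumes "subspace W"
  shows "dim (pq_perp W) + dim W = CARD('p) + CARD('q)"
proof -
  have "subspace (pq_flip ` W)"
    using assms linear_pq_flip by (rule linear_subspace_image[rotated])
  moreover have "inj pq_flip"
    by (metis injI pq_flip_flip)
  ultimately have "dim {y \<in> UNIV. \<forall>x\<in>pq_flip ` W. orthogonal x y} + dim W
      = DIM(real ^ ('p + 'q))"
    using dim_subspace_orthogonal_to_vectors[of "pq_flip ` W" UNIV]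
      dim_image_eq[OF linear_pq_flip, of W] inj_on_subset by fastforce
  moreover have "{y \<in> UNIV. \<forall>x\<in>pq_flip ` W. orthogonal x y} = pq_perp W"
    by (auto simp: pq_perp_def pq_form_eq_inner orthogonal_def inner_commute)
  ultimately show ?thesis
    by (simp flip: UNIV_Plus_UNIV add: card_Plus)
qed

section \<open>Negative definite subspaces of maximal dimension\<close>

text \<open>Serves \<open>pos_definite_on_pq_perp\<close>: for dimension reasons such a subspace
  meets every subspace of dimension q + 1 nontrivially.\<close>

lemma pos_definite_on_Inl_subspace:
  obtains P :: "(real ^ ('p::finite + 'q::finite)) set"
  where "subspace P" "dim P = CARD('p)" "pos_definite_on P"
proof -
  define P where "P = {x :: real ^ ('p + 'q). \<forall>i. i \<notin> range Inl \<longrightarrow> x $ i = 0}"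
  have "subspace P"
    by (auto simp: subspace_def P_def)
  moreover have "dim P = CARD('p)"
    using dim_substandard_cart[where ?'a = real, of "range Inl :: ('p + 'q) set"]
    by (simp add: P_def dim_vec_eq card_image)
  moreover have "pq_form x x > 0" if "x \<in> P" "x \<noteq> 0" for x
  proof -
    have "x $ Inr b = 0" for b
      using that(1) by (auto simp: P_def)
    then have "pq_flip x = x"
      by (simp add: pq_flip_def vec_eq_iff split: sum.split)
    with that(2) show ?thesis by (simp add: pq_form_eq_inner)
  qed
  ultimately show ?thesis
    using that by (auto simp: pos_definite_on_def)
qed

section \<open>Reflections\<close>

text \<open>Row \<open>k\<close> equals \<open>y\<close>, so multiples of \<open>y\<close> can be
  removed from the other rows without changing the determinant; the identity with one row replaced
  remains, and Cramer's lemma evaluates it.\<close>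

lemma det_rows_replaced_by_elementary:
  fixes x y :: "real ^ 'n::finite"
  assumes "finite T" "k \<notin> T"
  shows "det (\<chi> i. if i = k then y else if i \<in> T then axis i 1 + x $ i *\<^sub>R y else axis i 1) = y $ k"
  using assms
proof (induction T rule: finite_induct)
  case empty
  have "det (\<chi> i. if i = k then \<Sum>j\<in>UNIV. y $ j *s row j (mat 1 :: real ^ 'n ^ 'n) else row i (mat 1)) = y $ k"
    using cramer_lemma_transpose[of k y "mat 1 :: real ^ 'n ^ 'n"] by simp
  moreover have "(\<Sum>j\<in>UNIV. y $ j *s row j (mat 1 :: real ^ 'n ^ 'n)) = y"
    by (simp add: vec_eq_iff row_def mat_def if_distrib cong: if_cong)
  moreover have "row i (mat 1) = (axis i 1 :: real ^ 'n)" for i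
    by (auto simp: vec_eq_iff row_def mat_def axis_def)
  ultimately show ?case by (simp cong: if_cong)
next
  case (insert i T)
  let ?A = "\<chi> i. if i = k then y else if i \<in> T then axis i 1 + x $ i *\<^sub>R y else axis i 1"
  have "i \<noteq> k" using insert by auto
  then have "det (\<chi> j. if j = i then row i ?A + x $ i *s row k ?A else row j ?A) = det ?A"
    by (rule det_row_operation)
  moreover have "(\<chi> j. if j = i then row i ?A + x $ i *s row k ?A else row j ?A) =
     (\<chi> j. if j = k then y else if j \<in> insert i T then axis j 1 + x $ j *\<^sub>R y else axis j 1)"
    using insert \<open>i \<noteq> k\<close> by (auto simp: vec_eq_iff row_def)
  ultimately show ?case using insert by simp
qed

text \<open>The determinant is additive in each row, so the rank one term is inserted row by row.
  \<open>T\<close> collects the rows that already carry it; a new row \<open>k\<close> contributes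
  \<open>x $ k\<close> times the determinant of
  \<open>det_rows_replaced_by_elementary\<close>.\<close>

lemma det_mat_1_plus_rank_one:
  fixes x y :: "real ^ 'n::finite"
  shows "det (mat 1 + (\<chi> i. x $ i *\<^sub>R y)) = 1 + x \<bullet> y"
proof -
  have "det (\<chi> i. if i \<in> T then axis i 1 + x $ i *\<^sub>R y else axis i 1) = 1 + (\<Sum>i\<in>T. x $ i * y $ i)"
    if "finite T" for T
    using that
  proof (induction T rule: finite_induct)
    case empty
    have "(\<chi> i. axis i 1) = (mat 1 :: real ^ 'n ^ 'n)"
      by (auto simp: vec_eq_iff mat_def axis_def)
    then show ?case by simp
  next
    case (insert k T)
    let ?c = "\<lambda>i. if i \<in> T then axis i 1 + x $ i *\<^sub>R y else axis i 1"
    have "(\<chi> i. if i \<in> insert k T then axis i 1 + x $ i *\<^sub>R y else axis i 1) =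
      (\<chi> i. if i = k then axis i 1 + x $ i *s y else ?c i)"
      by (auto simp: vec_eq_iff)
    then have "det (\<chi> i. if i \<in> insert k T then axis i 1 + x $ i *\<^sub>R y else axis i 1) =
      det (\<chi> i. if i = k then axis i 1 else ?c i) + x $ k * det (\<chi> i. if i = k then y else ?c i)"
      using det_row_mul[of k "x $ k" "\<lambda>_. y" ?c]
        det_row_add[of k "\<lambda>i. axis i 1" "\<lambda>i. x $ i *s y" ?c]
      by (simp cong: if_cong)
    moreover have "(\<chi> i. if i = k then axis i 1 else ?c i) = (\<chi> i. ?c i)"
      using insert by (auto simp: vec_eq_iff)
    ultimately show ?case
      using insert det_rows_replaced_by_elementary[of T k y x] by simp
  qed
  from this[of UNIV] have "det (\<chi> i. axis i 1 + x $ i *\<^sub>R y) = 1 + x \<bullet> y"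
    by (simp add: inner_vec_def)
  moreover have "(\<chi> i. axis i 1 + x $ i *\<^sub>R y) = mat 1 + (\<chi> i. x $ i *\<^sub>R y)"
    by (auto simp: vec_eq_iff mat_def axis_def)
  ultimately show ?thesis by simp
qed

text \<open>Written as the identity plus a rank one matrix so that
  \<open>det_mat_1_plus_rank_one\<close> applies. For isotropic \<open>a\<close> the division by
  zero yields the identity, which is still an isometry.\<close>

definition pq_reflection :: "real ^ ('p::finite + 'q::finite) \<Rightarrow> real ^ ('p + 'q) ^ ('p + 'q)" where
  "pq_reflection a = mat 1 + (\<chi> i. (- 2 / pq_form a a * a $ i) *\<^sub>R pq_flip a)"

lemma pq_reflection_apply:
  "pq_reflection a *v x = x - (2 * pq_form x a / pq_form a a) *\<^sub>R a"
proof -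
  have "(\<chi> i. (- 2 / pq_form a a * a $ i) *\<^sub>R pq_flip a) *v x
      = (- 2 / pq_form a a * (x \<bullet> pq_flip a)) *\<^sub>R a"
    by (simp add: vec_eq_iff matrix_vector_mult_def inner_vec_def sum_distrib_left
        sum_divide_distrib mult_ac flip: sum_negf)
  then show ?thesis
    by (simp add: pq_reflection_def matrix_vector_mult_add_rdistrib pq_form_eq_inner[of x a])
qed

lemma det_pq_reflection:
  assumes "pq_form a a \<noteq> 0"
  shows "det (pq_reflection a) = - 1"
  using assms det_mat_1_plus_rank_one[of "(- 2 / pq_form a a) *\<^sub>R a" "pq_flip a"]
  by (simp add: pq_reflection_def pq_form_eq_inner[of a a])

definition pq_isometry :: "real ^ ('p::finite + 'q::finite) ^ ('p + 'q) \<Rightarrow> bool" where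
  "pq_isometry A \<longleftrightarrow> (\<forall>x y. pq_form (A *v x) (A *v y) = pq_form x y)"

lemma pq_isometry_mult: "pq_isometry A \<Longrightarrow> pq_isometry B \<Longrightarrow> pq_isometry (A ** B)"
  by (simp add: pq_isometry_def flip: matrix_vector_mul_assoc)

lemma pq_isometry_reflection: "pq_isometry (pq_reflection a)"
proof (cases "pq_form a a = 0")
  case True
  then show ?thesis by (simp add: pq_isometry_def pq_reflection_apply)
next
  case False
  show ?thesis
    unfolding pq_isometry_def
  proof (intro allI)
    fix x y
    have "pq_form a y = pq_form y a" by (rule pq_form_sym)
    with False show "pq_form (pq_reflection a *v x) (pq_reflection a *v y) = pq_form x y"
      by (simp add: pq_reflection_apply)
  qed
qed

section \<open>Hyperbolic boosts\<close>

text \<open>Composing the reflections in two unit space-like vectors at hyperbolic angle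
  \<open>c / 2\<close> gives the boost of parameter \<open>c\<close>; determinant 1 and invariance
  of the form are then inherited from reflections.\<close>

definition pq_boost :: "real ^ ('p::finite + 'q::finite) \<Rightarrow> real ^ ('p + 'q) \<Rightarrow> real
    \<Rightarrow> real ^ ('p + 'q) ^ ('p + 'q)" where
  "pq_boost v w c = pq_reflection (cosh (c / 2) *\<^sub>R w + sinh (c / 2) *\<^sub>R v) ** pq_reflection w"

lemma pq_form_half_boost:
  fixes c :: real
  assumes "pq_form v v = - 1" "pq_form w w = 1" "pq_form v w = 0"
  defines "a \<equiv> cosh (c / 2) *\<^sub>R w + sinh (c / 2) *\<^sub>R v"
  shows "pq_form a a = 1"
  using assms hyperbolic_pythagoras[of "c / 2"]
  by (simp add: pq_form_sym[of w v] power2_eq_square algebra_simps)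

text \<open>With N(x) = <x,w> v - <x,v> w, the right-hand side is x + sinh c N(x) + (cosh c - 1)
  N(N(x)), the shape that \<open>matrix_exp_of_cube\<close> produces. The proof eliminates the
  half-parameter values \<open>C\<close> and \<open>S\<close> by the double-argument
  formulas.\<close>

lemma pq_boost_apply:
  assumes v: "pq_form v v = - 1" and w: "pq_form w w = 1" and vw: "pq_form v w = 0"
  shows "pq_boost v w c *v x = x + sinh c *\<^sub>R (pq_form x w *\<^sub>R v - pq_form x v *\<^sub>R w)
    + (cosh c - 1) *\<^sub>R (pq_form x w *\<^sub>R w - pq_form x v *\<^sub>R v)"
proof -
  define C where "C = cosh (c / 2)"
  define S where "S = sinh (c / 2)"
  have CS: "C * C = 1 + S * S"
    using hyperbolic_pythagoras[of "c / 2"] by (simp add: C_def S_def power2_eq_square)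
  have c: "cosh c = 1 + 2 * (S * S)" "sinh c = 2 * S * C"
    using cosh_double[of "c / 2"] sinh_double[of "c / 2"] CS
    by (simp_all add: C_def S_def power2_eq_square)
  define a where "a = C *\<^sub>R w + S *\<^sub>R v"
  have a: "pq_form a a = 1"
    using pq_form_half_boost[OF assms] by (simp add: a_def C_def S_def)
  define y where "y = x - (2 * pq_form x w) *\<^sub>R w"
  define k where "k = 2 * (S * pq_form x v - C * pq_form x w)"
  have wv: "pq_form w v = 0" using vw pq_form_sym[of w v] by simp
  have y: "2 * pq_form y a = k"
    using vw wv w by (simp add: y_def a_def k_def algebra_simps)
  have "pq_boost v w c *v x = y - (2 * pq_form y a) *\<^sub>R a"
    using w by (simp add: pq_boost_def pq_reflection_apply a y_def
        flip: matrix_vector_mul_assoc a_def C_def S_def)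
  also have "\<dots> = x - (2 * pq_form x w + k * C) *\<^sub>R w - (k * S) *\<^sub>R v"
    unfolding y by (simp add: y_def a_def algebra_simps)
  also have "2 * pq_form x w + k * C = sinh c * pq_form x v - (cosh c - 1) * pq_form x w"
  proof -
    have "k * C = 2 * S * C * pq_form x v - 2 * (C * C) * pq_form x w"
      by (simp add: k_def algebra_simps)
    then show ?thesis unfolding CS c by (simp add: algebra_simps)
  qed
  also have "k * S = (cosh c - 1) * pq_form x v - sinh c * pq_form x w"
    by (simp add: k_def c algebra_simps)
  finally show ?thesis by (simp add: algebra_simps)
qed

lemma
  assumes "pq_form v v = - 1" "pq_form w w = 1" "pq_form v w = 0"
  shows det_pq_boost: "det (pq_boost v w c) = 1"
    and pq_isometry_boost: "pq_isometry (pq_boost v w c)"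
  using assms pq_form_half_boost[OF assms, of c]
  by (simp_all add: pq_boost_def det_mul det_pq_reflection pq_isometry_mult pq_isometry_reflection)

lemma pq_boost_v:
  assumes "pq_form v v = - 1" "pq_form w w = 1" "pq_form v w = 0"
  shows "pq_boost v w c *v v = cosh c *\<^sub>R v + sinh c *\<^sub>R w"
  using assms by (simp add: pq_boost_apply algebra_simps)

section \<open>The matrix exponential\<close>

text \<open>The cube relation reduces every positive power to a multiple of \<open>X\<close> or
  \<open>X ** X\<close>. The exponent is \<open>Suc k\<close> because the power 0 is
  \<open>mat 1\<close>, which breaks the pattern of the even powers.\<close>

lemma matrix_power_of_cube:
  fixes X :: "real ^ 'n::finite ^ 'n"
  assumes "X ** (X ** X) = c\<^sup>2 *\<^sub>R X" and "c \<noteq> 0"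
  shows "((**) X ^^ Suc k) (mat 1) = (if even k then c ^ k *\<^sub>R X else (c ^ Suc k / c\<^sup>2) *\<^sub>R (X ** X))"
proof (induction k)
  case 0
  show ?case by simp
next
  case (Suc k)
  have "((**) X ^^ Suc (Suc k)) (mat 1) = X ** ((**) X ^^ Suc k) (mat 1)"
    by simp
  then show ?case
    using assms unfolding Suc.IH by (simp add: matrix_scalar_ac power2_eq_square flip: scalar_matrix_assoc)
qed

lemma matrix_exp_of_cube:
  fixes X :: "real ^ 'n::finite ^ 'n"
  assumes "X ** (X ** X) = c\<^sup>2 *\<^sub>R X" and "c \<noteq> 0"
  shows "matrix_exp X = mat 1 + (sinh c / c) *\<^sub>R X + ((cosh c - 1) / c\<^sup>2) *\<^sub>R (X ** X)"
proof -
  \<comment> \<open>The even powers are \<open>c ^ k\<close> times \<open>Y\<close> only from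
    \<open>k = 2\<close> on. At \<open>k = 0\<close> the cosh series contributes \<open>Y\<close>
    instead of \<open>mat 1\<close>; the single extra term \<open>mat 1 - Y\<close> corrects
    this.\<close>
  define Y where "Y = (1 / c\<^sup>2) *\<^sub>R (X ** X)"
  have sums: "(\<lambda>k. (if k = 0 then mat 1 - Y else 0)
      + (if even k then 0 else c ^ k /\<^sub>R fact k) *\<^sub>R ((1 / c) *\<^sub>R X)
      + (if even k then c ^ k /\<^sub>R fact k else 0) *\<^sub>R Y)
    sums ((mat 1 - Y) + sinh c *\<^sub>R ((1 / c) *\<^sub>R X) + cosh c *\<^sub>R Y)"
    by (intro sums_add sums_scaleR_left sinh_converges cosh_converges
        sums_single[of 0 "\<lambda>_. mat 1 - Y"])
  have eq: "(\<lambda>k. (if k = 0 then mat 1 - Y else 0)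
      + (if even k then 0 else c ^ k /\<^sub>R fact k) *\<^sub>R ((1 / c) *\<^sub>R X)
      + (if even k then c ^ k /\<^sub>R fact k else 0) *\<^sub>R Y)
    = (\<lambda>k. (1 / fact k) *\<^sub>R ((**) X ^^ k) (mat 1))"
  proof
    fix k
    show "(if k = 0 then mat 1 - Y else 0)
        + (if even k then 0 else c ^ k /\<^sub>R fact k) *\<^sub>R ((1 / c) *\<^sub>R X)
        + (if even k then c ^ k /\<^sub>R fact k else 0) *\<^sub>R Y
      = (1 / fact k) *\<^sub>R ((**) X ^^ k) (mat 1)"
    proof (cases k)
      case 0
      then show ?thesis by simp
    next
      case (Suc j)
      show ?thesis
        unfolding Suc matrix_power_of_cube[OF assms]
        using assms(2) by (simp add: Y_def divide_inverse mult_ac)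
    qed
  qed
  have "matrix_exp X = (mat 1 - Y) + sinh c *\<^sub>R ((1 / c) *\<^sub>R X) + cosh c *\<^sub>R Y"
    unfolding matrix_exp_def using sums[unfolded eq] by (rule sums_unique[symmetric])
  then show ?thesis
    by (simp add: Y_def algebra_simps diff_divide_distrib)
qed

lemma matrix_exp_zero: "matrix_exp (0 :: real ^ 'n::finite ^ 'n) = mat 1"
proof -
  have "(\<lambda>k. (1 / fact k) *\<^sub>R ((**) (0 :: real ^ 'n ^ 'n) ^^ k) (mat 1)) =
      (\<lambda>k. if k = 0 then mat 1 else 0)"
    by (rule ext, case_tac k) simp_all
  with sums_single[of 0 "\<lambda>_. mat 1 :: real ^ 'n ^ 'n"] show ?thesis
    unfolding matrix_exp_def by (auto dest: sums_unique)
qed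

text \<open>\<open>X\<close> is c times the map exchanging \<open>v\<close> and \<open>w\<close> and
  vanishing on their orthogonal complement, whence the cube relation. The case \<open>c = 0\<close>
  is separate because \<open>matrix_exp_of_cube\<close> divides by \<open>c\<close>.\<close>

lemma matrix_exp_eq_pq_boost:
  assumes v: "pq_form v v = - 1" and w: "pq_form w w = 1" and vw: "pq_form v w = 0"
    and X: "\<And>x. X *v x = c *\<^sub>R (pq_form x w *\<^sub>R v - pq_form x v *\<^sub>R w)"
  shows "matrix_exp X = pq_boost v w c"
proof (cases "c = 0")
  case True
  then have "X = 0"
    using X by (simp add: matrix_eq)
  then show ?thesis
    using True pq_boost_apply[OF v w vw, of c] by (simp add: matrix_exp_zero) (simp add: matrix_eq)
next
  case False
  have wv: "pq_form w v = 0" using vw pq_form_sym[of w v] by simp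
  have XX: "X *v (X *v x) = c\<^sup>2 *\<^sub>R (pq_form x w *\<^sub>R w - pq_form x v *\<^sub>R v)" for x
    by (simp add: X v w vw wv power2_eq_square algebra_simps)
  have XXX: "X *v (X *v (X *v x)) = c\<^sup>2 *\<^sub>R (X *v x)" for x
    unfolding XX[of "X *v x"] by (simp add: X v w vw wv algebra_simps)
  have cube: "X ** (X ** X) = c\<^sup>2 *\<^sub>R X"
    using XXX by (simp add: matrix_eq scaleR_matrix_vector_assoc flip: matrix_vector_mul_assoc)
  have "(X ** X) *v x = c\<^sup>2 *\<^sub>R (pq_form x w *\<^sub>R w - pq_form x v *\<^sub>R v)" for x
    by (simp add: XX flip: matrix_vector_mul_assoc)
  then show ?thesis
    unfolding matrix_exp_of_cube[OF cube False] using False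
    by (simp add: matrix_eq matrix_vector_mult_add_rdistrib X
        pq_boost_apply[OF v w vw] flip: scaleR_matrix_vector_assoc)
qed

section \<open>The Lie algebra\<close>

lemma Hpq_normalized:
  assumes "pt \<in> Hpq"
  obtains v where "pq_form v v = - 1" "pt = span {v}"
proof -
  obtain u where u: "pq_form u u < 0" "pt = span {u}"
    using assms by (auto simp: Hpq_def)
  define r where "r = 1 / sqrt (- pq_form u u)"
  have "r \<noteq> 0" using u by (simp add: r_def)
  have "pq_form (r *\<^sub>R u) (r *\<^sub>R u) = r\<^sup>2 * pq_form u u"
    by (simp add: power2_eq_square)
  also have "\<dots> = - 1"
    using u by (simp add: r_def power_divide)
  finally have "pq_form (r *\<^sub>R u) (r *\<^sub>R u) = - 1" .
  moreover have "span {r *\<^sub>R u} = span {u}"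
    using span_image_scale[of "{u}" "\<lambda>_. r"] \<open>r \<noteq> 0\<close> by simp
  ultimately show ?thesis using that u(2) by blast
qed

section \<open>Orthogonal splitting along a maximal negative definite subspace\<close>

lemma X_G_decomposition:
  assumes "\<tau> \<in> X_G"
  obtains y z where "y \<in> \<tau>" "z \<in> pq_perp \<tau>" "x = y + z"
proof -
  have \<tau>: "subspace \<tau>" "neg_definite_on \<tau>"
    using assms by (auto simp: X_G_def)
  \<comment> \<open>A common vector would be isotropic in the negative definite space \<tau>. The
    intersection being trivial, the dimensions of \<tau> and its complement add up to that of the
    whole space.\<close>
  have "\<tau> \<inter> pq_perp \<tau> = {0}"
    using \<tau> subspace_0[OF \<tau>(1)] subspace_0[OF subspace_pq_perp, of \<tau>]
    by (force simp: neg_definite_on_def pq_perp_def)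
  then have "dim {y + z |y z. y \<in> \<tau> \<and> z \<in> pq_perp \<tau>} = dim \<tau> + dim (pq_perp \<tau>)"
    using dim_sums_Int[OF \<tau>(1) subspace_pq_perp[of \<tau>]] by simp
  also have "\<dots> = dim (UNIV :: (real ^ ('a + 'b)) set)"
    using dim_pq_perp[OF \<tau>(1)] by (simp flip: UNIV_Plus_UNIV add: card_Plus)
  finally have "{y + z |y z. y \<in> \<tau> \<and> z \<in> pq_perp \<tau>} = UNIV"
    using subspace_sums[OF \<tau>(1) subspace_pq_perp[of \<tau>]]
    by (metis (no_types, lifting) dim_eq_full span_eq_iff dim_UNIV)
  then show ?thesis using that by blast
qed

text \<open>Otherwise \<tau> together with a nonpositive \<open>x\<close> would span a space of
  dimension q + 1 on which the form is nonpositive, and this space would share a nonzero vector with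
  a positive definite space of dimension p.\<close>

lemma pos_definite_on_pq_perp:
  fixes \<tau> :: "(real ^ ('p::finite + 'q::finite)) set"
  assumes "\<tau> \<in> X_G"
  shows "pos_definite_on (pq_perp \<tau>)"
  unfolding pos_definite_on_def
proof (intro ballI impI)
  fix x assume x: "x \<in> pq_perp \<tau>" "x \<noteq> 0"
  have \<tau>: "subspace \<tau>" "neg_definite_on \<tau>" "dim \<tau> = CARD('q)"
    using assms by (auto simp: X_G_def)
  show "pq_form x x > 0"
  proof (rule ccontr)
    assume neg: "\<not> pq_form x x > 0"
    obtain P :: "(real ^ ('p + 'q)) set"
      where P: "subspace P" "dim P = CARD('p)" "pos_definite_on P"
      by (rule pos_definite_on_Inl_subspace)
    have "x \<notin> \<tau>"
      using x \<tau> by (force simp: neg_definite_on_def pq_perp_def)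
    then have "dim (span (insert x \<tau>)) = Suc CARD('q)"
      using \<tau> by (simp add: dim_insert span_eq_iff[THEN iffD2])
    moreover have "dim {y + z |y z. y \<in> span (insert x \<tau>) \<and> z \<in> P} \<le> CARD('p) + CARD('q)"
      using dim_subset_UNIV[of "{y + z |y z. y \<in> span (insert x \<tau>) \<and> z \<in> P}"]
      by (simp flip: UNIV_Plus_UNIV add: card_Plus)
    ultimately have "dim (span (insert x \<tau>) \<inter> P) > 0"
      using dim_sums_Int[OF subspace_span[of "insert x \<tau>"] P(1)] P(2) by linarith
    then obtain y where y: "y \<in> span (insert x \<tau>)" "y \<in> P" "y \<noteq> 0"
      by (metis Int_iff dim_eq_0 less_numeral_extra(3) singletonI subsetI)
    then obtain k where "y - k *\<^sub>R x \<in> \<tau>"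
      using \<tau> by (auto simp: span_insert span_eq_iff[THEN iffD2])
    then obtain t where t: "t \<in> \<tau>" "y = t + k *\<^sub>R x"
      by (metis diff_add_cancel)
    have "pq_form x t = 0" "pq_form t x = 0"
      using x t by (auto simp: pq_perp_def pq_form_sym[of t])
    then have "pq_form y y = pq_form t t + k * k * pq_form x x"
      by (simp add: t algebra_simps)
    moreover have "pq_form t t \<le> 0"
      using \<tau> t by (cases "t = 0") (auto simp: neg_definite_on_def less_imp_le)
    moreover have "k * k * pq_form x x \<le> 0"
      using neg by (simp add: mult_nonneg_nonpos)
    moreover have "pq_form y y > 0"
      using P y by (auto simp: pos_definite_on_def)
    ultimately show False by linarith
  qed
qed

text \<open>Provides the material for an explicit formula for \<open>tau_inner\<close>. The
  component in \<tau> is chosen pointwise; its uniqueness makes the choice linear.\<close>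

lemma X_G_projection:
  assumes "\<tau> \<in> X_G"
  obtains \<pi> where "linear \<pi>" "\<And>x. \<pi> x \<in> \<tau>" "\<And>x. x - \<pi> x \<in> pq_perp \<tau>"
    "\<And>x. x \<in> \<tau> \<Longrightarrow> \<pi> x = x" "\<And>x. x \<in> pq_perp \<tau> \<Longrightarrow> \<pi> x = 0"
proof -
  have \<tau>: "subspace \<tau>" "neg_definite_on \<tau>"
    using assms by (auto simp: X_G_def)
  have "\<exists>y. y \<in> \<tau> \<and> x - y \<in> pq_perp \<tau>" for x
    by (rule X_G_decomposition[OF assms, of x]) auto
  then obtain \<pi> where \<pi>: "\<And>x. \<pi> x \<in> \<tau>" "\<And>x. x - \<pi> x \<in> pq_perp \<tau>"
    by metis
  have unique: "\<pi> x = y" if "y \<in> \<tau>" "x - y \<in> pq_perp \<tau>" for x y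
  proof -
    have "y - \<pi> x \<in> \<tau>"
      using \<tau> \<pi> that by (simp add: subspace_diff)
    moreover have "(x - \<pi> x) - (x - y) \<in> pq_perp \<tau>"
      using \<pi> that subspace_diff[OF subspace_pq_perp] by blast
    ultimately show ?thesis
      using \<tau> by (force simp: neg_definite_on_def pq_perp_def)
  qed
  show ?thesis
  proof (rule that[OF _ \<pi>])
    show "linear \<pi>"
    proof (rule linearI)
      fix x y and c :: real
      have "(x - \<pi> x) + (y - \<pi> y) \<in> pq_perp \<tau>" "c *\<^sub>R (x - \<pi> x) \<in> pq_perp \<tau>"
        using \<pi> subspace_add[OF subspace_pq_perp] subspace_scale[OF subspace_pq_perp] by blast+
      then show "\<pi> (x + y) = \<pi> x + \<pi> y" "\<pi> (c *\<^sub>R x) = c *\<^sub>R \<pi> x"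
        using \<tau> \<pi> by (auto intro!: unique simp: subspace_add subspace_scale algebra_simps)
    qed
    show "\<pi> x = x" if "x \<in> \<tau>" for x
      using that by (intro unique) (auto simp: subspace_0 subspace_pq_perp)
    show "\<pi> x = 0" if "x \<in> pq_perp \<tau>" for x
      using that \<tau> by (intro unique) (auto simp: subspace_0)
  qed
qed

text \<open>\<open>tau_inner\<close> is a definite description, so existence and uniqueness come
  first. The witness \<open>K\<close> reverses the sign of the form on the \<tau> components; a
  bilinear map is determined by its values on the four blocks of the splitting.\<close>

lemma
  assumes "\<tau> \<in> X_G"
  shows bilinear_tau_inner: "bilinear (tau_inner \<tau>)"
    and tau_inner_tau: "\<And>x y. x \<in> \<tau> \<Longrightarrow> y \<in> \<tau> \<Longrightarrow> tau_inner \<tau> x y = - pq_form x y"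
    and tau_inner_mixed: "\<And>x y. x \<in> \<tau> \<Longrightarrow> y \<in> pq_perp \<tau> \<Longrightarrow> tau_inner \<tau> x y = 0"
      "\<And>x y. x \<in> \<tau> \<Longrightarrow> y \<in> pq_perp \<tau> \<Longrightarrow> tau_inner \<tau> y x = 0"
proof -
  obtain \<pi> where \<pi>: "linear \<pi>" "\<And>x. \<pi> x \<in> \<tau>" "\<And>x. x - \<pi> x \<in> pq_perp \<tau>"
    "\<And>x. x \<in> \<tau> \<Longrightarrow> \<pi> x = x" "\<And>x. x \<in> pq_perp \<tau> \<Longrightarrow> \<pi> x = 0"
    using X_G_projection[OF assms] by blast
  let ?P = "\<lambda>K. bilinear K \<and>
     (\<forall>x\<in>\<tau>. \<forall>y\<in>\<tau>. K x y = - pq_form x y) \<and>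
     (\<forall>x\<in>pq_perp \<tau>. \<forall>y\<in>pq_perp \<tau>. K x y = pq_form x y) \<and>
     (\<forall>x\<in>\<tau>. \<forall>y\<in>pq_perp \<tau>. K x y = 0 \<and> K y x = 0)"
  define K where "K x y = pq_form (x - \<pi> x) (y - \<pi> y) - pq_form (\<pi> x) (\<pi> y)" for x y
  have "bilinear K"
    using \<pi>(1) by (auto simp: bilinear_def K_def linear_iff algebra_simps)
  then have "?P K"
    using \<pi> by (simp add: K_def)
  moreover have "L = K" if L: "?P L" for L
  proof (intro ext)
    fix x y
    have *: "M x y = M (\<pi> x) (\<pi> y) + M (\<pi> x) (y - \<pi> y) + M (x - \<pi> x) (\<pi> y) + M (x - \<pi> x) (y - \<pi> y)"
      if "bilinear M" for M :: "_ \<Rightarrow> _ \<Rightarrow> real"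
      using that by (simp add: bilinear_lsub bilinear_rsub)
    show "L x y = K x y"
      using * [of L] *[of K] L \<open>?P K\<close> \<pi>(2,3) by simp
  qed
  ultimately have "?P (tau_inner \<tau>)"
    unfolding tau_inner_def by (rule theI)
  then show "bilinear (tau_inner \<tau>)"
    "\<And>x y. x \<in> \<tau> \<Longrightarrow> y \<in> \<tau> \<Longrightarrow> tau_inner \<tau> x y = - pq_form x y"
    "\<And>x y. x \<in> \<tau> \<Longrightarrow> y \<in> pq_perp \<tau> \<Longrightarrow> tau_inner \<tau> x y = 0"
    "\<And>x y. x \<in> \<tau> \<Longrightarrow> y \<in> pq_perp \<tau> \<Longrightarrow> tau_inner \<tau> y x = 0"
    by blast+
qed

text \<open>As <v,v> = -1, the projection of \<open>x\<close> to the line of \<open>v\<close> is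
  -<x,v> v, and the involution is twice this projection minus the identity. Uniqueness of the
  description holds since the line and its complement span everything.\<close>

lemma J_pt_span_apply:
  assumes v: "pq_form v v = - 1"
  shows "J_pt (span {v}) *v x = - (2 * pq_form x v) *\<^sub>R v - x"
proof -
  let ?P = "\<lambda>J. (\<forall>x\<in>span {v}. J *v x = x) \<and> (\<forall>x\<in>pq_perp (span {v}). J *v x = - x)"
  define J where "J = matrix (\<lambda>x. - (2 * pq_form x v) *\<^sub>R v - x)"
  have "linear (\<lambda>x. - (2 * pq_form x v) *\<^sub>R v - x)"
    by (rule linearI) (auto simp: algebra_simps)
  then have J: "J *v x = - (2 * pq_form x v) *\<^sub>R v - x" for x
    by (simp add: J_def matrix_works)
  have perp: "x + pq_form x v *\<^sub>R v \<in> pq_perp (span {v})" for x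
    using v by (auto simp: pq_perp_def span_singleton)
  have "?P J"
    using v by (auto simp: J span_singleton pq_perp_def) (simp add: vec_eq_iff)
  moreover have "L = J" if L: "?P L" for L
  proof -
    have "L *v x = J *v x" for x
    proof -
      have *: "M *v x = M *v (x + pq_form x v *\<^sub>R v) - pq_form x v *\<^sub>R (M *v v)"
        for M :: "real ^ ('a + 'b) ^ ('a + 'b)"
        by (simp add: matrix_vector_right_distrib matrix_vector_mult_scaleR)
      have "v \<in> span {v}" by (simp add: span_base)
      then show ?thesis
        using *[of L] *[of J] L \<open>?P J\<close> perp[of x] by simp
    qed
    then show ?thesis by (simp add: matrix_eq)
  qed
  ultimately have "J_pt (span {v}) = J"
    unfolding J_pt_def by (rule the_equality)
  then show ?thesis by (simp add: J)
qed

text \<open>Anticommuting with the involution forces \<open>X\<close> to exchange the line of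
  \<open>v\<close> with its complement, and skewness ties the two off-diagonal blocks to each other.
  Hence \<open>X\<close> is known from \<open>X *v v\<close>.\<close>

lemma q_part_apply:
  assumes v: "pq_form v v = - 1" and X: "X \<in> q_part (span {v})"
  shows "pq_form (X *v v) v = 0"
    and "X *v x = pq_form x (X *v v) *\<^sub>R v - pq_form x v *\<^sub>R (X *v v)"
proof -
  have so: "pq_form (X *v x) y = - pq_form x (X *v y)" for x y
    using X by (simp add: q_part_def so_pq_def add_eq_0_iff2)
  show Xv: "pq_form (X *v v) v = 0"
    using so[of v v] pq_form_sym[of v "X *v v"] by simp
  \<comment> \<open>The component of \<open>x\<close> orthogonal to \<open>v\<close>; the involution
    negates it, so \<open>X *v y\<close> must be a multiple of \<open>v\<close>.\<close>
  define y where "y = x + pq_form x v *\<^sub>R v"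
  have y: "pq_form y v = 0"
    using v by (simp add: y_def)
  have "J_pt (span {v}) ** X ** J_pt (span {v}) + X = 0"
    using X by (simp add: q_part_def)
  then have "(J_pt (span {v}) ** X ** J_pt (span {v}) + X) *v y = 0"
    by simp
  then have "J_pt (span {v}) *v (X *v (J_pt (span {v}) *v y)) + X *v y = 0"
    by (simp add: matrix_vector_mult_add_rdistrib matrix_vector_mul_assoc matrix_mul_assoc)
  then have "2 *\<^sub>R (X *v y) = 2 *\<^sub>R (- pq_form (X *v y) v *\<^sub>R v)"
    using y by (simp add: J_pt_span_apply[OF v] vec.neg scaleR_2 algebra_simps
        eq_neg_iff_add_eq_0)
  then have "X *v y = - pq_form (X *v y) v *\<^sub>R v"
    by (metis scaleR_cancel_left zero_neq_numeral)
  also have "pq_form (X *v y) v = - pq_form x (X *v v)"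
    using Xv so[of y v] by (simp add: y_def pq_form_sym[of v "X *v v"])
  finally show "X *v x = pq_form x (X *v v) *\<^sub>R v - pq_form x v *\<^sub>R (X *v v)"
    by (simp add: y_def matrix_vector_right_distrib matrix_vector_mult_scaleR algebra_simps)
qed

text \<open>When one argument lies in \<tau>, \<open>tau_inner\<close> is minus the form. For
  \<open>v\<close> and \<open>y\<close> in \<tau>, symmetry therefore gives <Xv,y> = <v,Xy>, while
  skewness gives <Xv,y> = -<v,Xy>.\<close>

lemma p_part_maps_to_perp:
  assumes "\<tau> \<in> X_G" "X \<in> p_part \<tau>" "v \<in> \<tau>"
  shows "X *v v \<in> pq_perp \<tau>"
proof -
  have "pq_form (X *v v) y = 0" if "y \<in> \<tau>" for y
  proof -
    have *: "tau_inner \<tau> z t = - pq_form z t" "tau_inner \<tau> t z = - pq_form z t" if "t \<in> \<tau>" for z t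
    proof -
      obtain a b where ab: "a \<in> \<tau>" "b \<in> pq_perp \<tau>" "z = a + b"
        by (rule X_G_decomposition[OF assms(1)])
      have "pq_form b t = 0" using ab that by (auto simp: pq_perp_def)
      then show "tau_inner \<tau> z t = - pq_form z t" "tau_inner \<tau> t z = - pq_form z t"
        using ab that bilinear_tau_inner[OF assms(1)] pq_form_sym[of t a]
        by (auto simp: bilinear_ladd bilinear_radd tau_inner_tau[OF assms(1)]
            tau_inner_mixed[OF assms(1)])
    qed
    have "tau_inner \<tau> (X *v v) y = tau_inner \<tau> v (X *v y)"
      using assms by (simp add: p_part_def)
    then have "pq_form (X *v v) y = pq_form (X *v y) v"
      using * that assms(3) by simp
    moreover have "pq_form (X *v v) y + pq_form v (X *v y) = 0"
      using assms by (simp add: p_part_def so_pq_def)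
    ultimately show ?thesis
      using pq_form_sym[of v "X *v y"] by simp
  qed
  then show ?thesis by (simp add: pq_perp_def)
qed

text \<open>This is where \<tau> matters: for q at least 2, an element of \<open>q_part\<close>
  alone may send \<open>v\<close> to a negative or isotropic vector, and its exponential is then a
  rotation or unipotent instead of a boost.\<close>

lemma p_part_q_part_normal_form:
  assumes v: "pq_form v v = - 1" and \<tau>: "\<tau> \<in> S_pt (span {v})"
    and X: "X \<in> p_part \<tau> \<inter> q_part (span {v})" "X \<noteq> 0"
  obtains s w where "s > 0" "pq_form w w = 1" "pq_form v w = 0"
    "\<And>x. X *v x = s *\<^sub>R (pq_form x w *\<^sub>R v - pq_form x v *\<^sub>R w)"
proof -
  define z where "z = X *v v"
  have X_apply: "X *v x = pq_form x z *\<^sub>R v - pq_form x v *\<^sub>R z" for x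
    unfolding z_def by (rule q_part_apply(2)[OF v]) (use X in blast)
  have "z \<noteq> 0"
    using X(2) X_apply by (auto simp: matrix_eq)
  moreover have "z \<in> pq_perp \<tau>"
    unfolding z_def using \<tau> X by (intro p_part_maps_to_perp) (auto simp: S_pt_def span_base)
  ultimately have pos: "pq_form z z > 0"
    using pos_definite_on_pq_perp[of \<tau>] \<tau> by (auto simp: S_pt_def pos_definite_on_def)
  have zv: "pq_form v z = 0"
    using q_part_apply(1)[OF v, of X] X pq_form_sym[of v z] unfolding z_def by auto
  define s where "s = sqrt (pq_form z z)"
  define w where "w = (1 / s) *\<^sub>R z"
  have s: "s > 0" "s * s = pq_form z z"
    using pos by (auto simp: s_def)
  have "z = s *\<^sub>R w" using s by (simp add: w_def)
  show ?thesis
  proof (rule that[OF s(1)])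
    show "pq_form w w = 1" using s by (simp add: w_def flip: s(2))
    show "pq_form v w = 0" using zv by (simp add: w_def)
    show "X *v x = s *\<^sub>R (pq_form x w *\<^sub>R v - pq_form x v *\<^sub>R w)" for x
      unfolding X_apply \<open>z = s *\<^sub>R w\<close> by (simp add: algebra_simps)
  qed
qed

section \<open>Projective classes\<close>

text \<open>Keeping the condition on \<open>c\<close> as a determinant treats even and odd
  dimensions at once.\<close>

lemma proj_class_eq:
  fixes A :: "real ^ 'n::finite ^ 'n"
  shows "proj_class A = {c *\<^sub>R A | c. det (c *\<^sub>R mat 1 :: real ^ 'n ^ 'n) = 1}"
proof -
  have "c *\<^sub>R mat 1 ** A = c *\<^sub>R A" for c
    by (simp flip: scalar_matrix_assoc)
  then show ?thesis
    by (fastforce simp: proj_class_def r_coset_def SL_scalars_def SL_def)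
qed

text \<open>The product of \<open>PSO\<close> is the product of cosets as sets; scalars commute with
  all matrices, so they can be collected in front.\<close>

lemma proj_class_mult:
  fixes A B :: "real ^ ('p::finite + 'q::finite) ^ ('p + 'q)"
  shows "proj_class A \<otimes>\<^bsub>PSO\<^esub> proj_class B = proj_class (A ** B)"
proof -
  have mult: "(c *\<^sub>R A) ** (d *\<^sub>R B) = (c * d) *\<^sub>R (A ** B)" for c d
    by (simp add: matrix_scalar_ac flip: scalar_matrix_assoc)
  have det: "det ((c * d) *\<^sub>R mat 1 :: real ^ ('p + 'q) ^ ('p + 'q)) = 1"
    if "det (c *\<^sub>R mat 1 :: real ^ ('p + 'q) ^ ('p + 'q)) = 1"
      "det (d *\<^sub>R mat 1 :: real ^ ('p + 'q) ^ ('p + 'q)) = 1" for c d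
  proof -
    have "(c * d) *\<^sub>R mat 1 = (c *\<^sub>R mat 1) ** (d *\<^sub>R mat 1 :: real ^ ('p + 'q) ^ ('p + 'q))"
      by (simp add: matrix_scalar_ac flip: scalar_matrix_assoc)
    then show ?thesis using that by (simp add: det_mul)
  qed
  have "proj_class A \<otimes>\<^bsub>PSO\<^esub> proj_class B = (\<Union>X\<in>proj_class A. \<Union>Y\<in>proj_class B. {X ** Y})"
    by (simp add: PSO_def PSL_def FactGroup_def set_mult_def SL_def)
  also have "\<dots> = proj_class (A ** B)"
  proof (intro equalityI subsetI)
    fix Z assume "Z \<in> (\<Union>X\<in>proj_class A. \<Union>Y\<in>proj_class B. {X ** Y})"
    then show "Z \<in> proj_class (A ** B)"
      by (auto simp: proj_class_eq mult intro: det)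
  next
    fix Z assume "Z \<in> proj_class (A ** B)"
    then obtain c where c: "det (c *\<^sub>R mat 1 :: real ^ ('p + 'q) ^ ('p + 'q)) = 1"
      "Z = (c *\<^sub>R A) ** (1 *\<^sub>R B)"
      unfolding mult by (auto simp: proj_class_eq)
    moreover have "1 *\<^sub>R B \<in> proj_class B"
      unfolding proj_class_eq by (rule CollectI, rule exI[of _ 1]) simp
    ultimately show "Z \<in> (\<Union>X\<in>proj_class A. \<Union>Y\<in>proj_class B. {X ** Y})"
      unfolding proj_class_eq[of A] by blast
  qed
  finally show ?thesis .
qed

lemma proj_act_proj_class_span:
  "proj_act (proj_class A) (span {v}) = span {A *v v}"
proof (intro equalityI subsetI)
  fix x assume "x \<in> proj_act (proj_class A) (span {v})"
  then obtain c k where "x = (c *\<^sub>R A) *v (k *\<^sub>R v)"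
    by (auto simp: proj_act_def proj_class_eq span_singleton)
  then have "x = (c * k) *\<^sub>R (A *v v)"
    by (simp add: matrix_vector_mult_scaleR flip: scaleR_matrix_vector_assoc)
  then show "x \<in> span {A *v v}" by (auto simp: span_singleton)
next
  fix x assume "x \<in> span {A *v v}"
  then obtain k where "x = (1 *\<^sub>R A) *v (k *\<^sub>R v)"
    by (auto simp: span_singleton matrix_vector_mult_scaleR)
  moreover have "1 *\<^sub>R A \<in> proj_class A"
    unfolding proj_class_eq by (rule CollectI, rule exI[of _ 1]) simp
  moreover have "k *\<^sub>R v \<in> span {v}" by (auto simp: span_singleton)
  ultimately show "x \<in> proj_act (proj_class A) (span {v})"
    unfolding proj_act_def by blast
qed

lemma carrier_PSO: "carrier PSO = {proj_class A | A. det A = 1 \<and> pq_isometry A}"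
  by (simp add: PSO_def SL_def pq_isometry_def)

lemma stabilizer_ptI:
  assumes "det H = 1" "pq_isometry H" "H *v v = e *\<^sub>R v" "e \<noteq> 0"
  shows "proj_class H \<in> stabilizer_pt (span {v})"
proof -
  have "span {H *v v} = span {v}"
    using span_image_scale[of "{v}" "\<lambda>_. e"] assms by simp
  with assms show ?thesis
    by (auto simp: stabilizer_pt_def carrier_PSO proj_act_proj_class_span)
qed

text \<open>Fixing the line of \<open>v\<close> allows \<open>v\<close> to be reversed, so a sign
  \<open>e\<close> has to be carried along; invariance of the form excludes other factors.\<close>

lemma stabilizer_ptE:
  assumes "h \<in> stabilizer_pt (span {v})" "pq_form v v = - 1"
  obtains H e where "h = proj_class H" "pq_isometry H" "H *v v = e *\<^sub>R v" "\<bar>e\<bar> = 1"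
proof -
  obtain H where H: "h = proj_class H" "pq_isometry H" "span {H *v v} = span {v}"
    using assms by (auto simp: stabilizer_pt_def carrier_PSO proj_act_proj_class_span)
  have "H *v v \<in> span {v}"
    using H(3) by (metis span_base singletonI)
  then obtain e where e: "H *v v = e *\<^sub>R v"
    by (auto simp: span_singleton)
  have "pq_form (H *v v) (H *v v) = pq_form v v"
    using H(2) by (simp add: pq_isometry_def)
  then have "e * e = 1" using assms(2) by (simp add: e)
  then have "\<bar>e\<bar> = 1" by (metis abs_square_eq_1 power2_eq_square)
  with H e that show ?thesis by blast
qed

section \<open>The decomposition\<close>

lemma exists_anisotropic_orthogonal:
  fixes v w :: "real ^ ('p::finite + 'q::finite)"
  assumes v: "pq_form v v = - 1" and w: "pq_form w w = 1" and vw: "pq_form v w = 0"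
    and d: "CARD('p) + CARD('q) > 2"
  obtains n where "pq_form v n = 0" "pq_form w n = 0" "pq_form n n \<noteq> 0"
proof -
  let ?W = "span {v, w}"
  have "card {v, w} \<le> 2"
    by (simp add: card_insert_if)
  then have "dim ?W \<le> 2"
    using dim_le_card'[of "{v, w}"] by (simp add: dim_span)
  then have "dim (pq_perp ?W) > 0"
    using dim_pq_perp[of ?W] d by simp
  then obtain m where m: "m \<in> pq_perp ?W" "m \<noteq> 0"
    by (metis dim_eq_0 less_numeral_extra(3) singletonI subsetI)
  have perp: "pq_form v x = 0 \<and> pq_form w x = 0" if "x \<in> pq_perp ?W" for x
    using that span_base[of _ "{v, w}"] by (auto simp: pq_perp_def pq_form_sym[of _ x])
  have m_perp: "pq_form v m = 0" "pq_form w m = 0" "pq_form m v = 0" "pq_form m w = 0"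
    using perp[OF m(1)] by (auto simp: pq_form_sym[of m])
  obtain y where y: "pq_form m y \<noteq> 0"
    using pq_form_nondegenerate[of m] m(2) by blast
  \<comment> \<open>A nonzero \<open>m\<close> in the complement may be isotropic, so a partner is
    sought. Removing from \<open>y\<close> its components along \<open>v\<close> and
    \<open>w\<close> keeps its pairing with \<open>m\<close>; the sign at \<open>v\<close> is
    positive because <v,v> = -1.\<close>
  define z where "z = y + pq_form v y *\<^sub>R v - pq_form w y *\<^sub>R w"
  have z: "pq_form v z = 0" "pq_form w z = 0" "pq_form m z \<noteq> 0"
    using v w vw pq_form_sym[of w v] y m_perp by (simp_all add: z_def)
  have sum: "pq_form (m + z) (m + z) = pq_form m m + 2 * pq_form m z + pq_form z z"
    using pq_form_sym[of z m] by simp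
  \<comment> \<open>Polarization: if \<open>m\<close> and \<open>z\<close> are both isotropic, then
    \<open>m + z\<close> has form value 2<m,z>, which is nonzero.\<close>
  consider "pq_form m m \<noteq> 0" | "pq_form z z \<noteq> 0" | "pq_form (m + z) (m + z) \<noteq> 0"
    using z(3) sum by fastforce
  then show ?thesis
  proof cases
    case 1
    with m_perp that show ?thesis by blast
  next
    case 2
    with z that show ?thesis by blast
  next
    case 3
    with z m_perp that[of "m + z"] show ?thesis by simp
  qed
qed

text \<open>For \<open>p = q = 1\<close> this fails with \<open>u = - w\<close>, since then the only isometries of determinant 1
  fixing \<open>v\<close> are trivial.\<close>

lemma transitive_on_unit_spacelike:
  fixes v w u :: "real ^ ('p::finite + 'q::finite)"
  assumes v: "pq_form v v = - 1" and w: "pq_form w w = 1" and vw: "pq_form v w = 0"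
    and u: "pq_form u u = 1" and vu: "pq_form v u = 0"
    and d: "CARD('p) + CARD('q) > 2"
  obtains H where "det H = 1" "pq_isometry H" "H *v v = v" "H *v w = u"
proof (cases "pq_form w u = - 1")
  case False
  \<comment> \<open>The first reflection sends \<open>w\<close> to \<open>- w\<close>, the second
    sends \<open>- w\<close> to \<open>u\<close>; \<open>w + u\<close> is anisotropic exactly
    because <w,u> differs from -1.\<close>
  define H where "H = pq_reflection (w + u) ** pq_reflection w"
  have uw: "pq_form u w = pq_form w u" by (rule pq_form_sym)
  have wu: "pq_form (w + u) (w + u) = 2 + 2 * pq_form w u"
    using w u uw by simp
  have "det H = 1" "pq_isometry H"
    using wu w False by (simp_all add: H_def det_mul det_pq_reflection pq_isometry_mult
        pq_isometry_reflection del: pq_form_add_left pq_form_add_right)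
  moreover have "H *v v = v"
    using vw vu by (simp add: H_def pq_reflection_apply flip: matrix_vector_mul_assoc)
  moreover have "H *v w = u"
  proof -
    have "pq_reflection w *v w = - w"
      using w by (simp add: pq_reflection_apply scaleR_2)
    moreover have "2 * pq_form (- w) (w + u) / pq_form (w + u) (w + u) = - 1"
      using w False unfolding wu by (simp add: field_simps)
    ultimately have "H *v w = - w - (- 1) *\<^sub>R (w + u)"
      unfolding H_def by (metis matrix_vector_mul_assoc pq_reflection_apply)
    then show ?thesis by simp
  qed
  ultimately show ?thesis using that by blast
next
  case True
  obtain n where n: "pq_form v n = 0" "pq_form w n = 0" "pq_form n n \<noteq> 0"
    by (rule exists_anisotropic_orthogonal[OF v w vw d])
  \<comment> \<open>Now \<open>w + u\<close> is isotropic, but the reflection in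
    \<open>w - u\<close> maps \<open>w\<close> to \<open>u\<close> directly. The reflection in
    \<open>n\<close>, which fixes \<open>v\<close> and \<open>w\<close>, restores determinant
    1.\<close>
  define H where "H = pq_reflection (w - u) ** pq_reflection n"
  have uw: "pq_form u w = - 1" using True pq_form_sym[of u w] by simp
  have wu: "pq_form (w - u) (w - u) = 4"
    using w u uw True by simp
  have "det H = 1" "pq_isometry H"
    using wu n by (simp_all add: H_def det_mul det_pq_reflection pq_isometry_mult
        pq_isometry_reflection del: pq_form_diff_left pq_form_diff_right)
  moreover have "H *v v = v" "H *v w = u"
    using vw vu n w u True uw by (simp_all add: H_def pq_reflection_apply flip: matrix_vector_mul_assoc)
  ultimately show ?thesis using that by blast
qed

section \<open>Factorization along a space-like geodesic\<close>

lemma signature_1_1_coordinates: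
  assumes V: "has_signature V 1 1" and v: "v \<in> V" "pq_form v v = - 1" and y: "y \<in> V"
  obtains u a b where "pq_form u u = 1" "pq_form v u = 0" "y = a *\<^sub>R v + b *\<^sub>R u"
proof -
  obtain P where P: "subspace P" "P \<subseteq> V" "dim P = 1" "pos_definite_on P"
    and sV: "subspace V" "dim V = 2"
    using V by (auto simp: has_signature_def)
  obtain e where e: "e \<in> P" "e \<noteq> 0"
    using P(3) dim_eq_0[of P] by fastforce
  then have "pq_form e e > 0" "e \<in> V"
    using P by (auto simp: pos_definite_on_def)
  \<comment> \<open>The part of the positive vector \<open>e\<close> orthogonal to \<open>v\<close>.
    Since \<open>v\<close> is negative, removing the other part only increases the form value, so
    \<open>f\<close> can be normalized.\<close>
  define f where "f = e + pq_form e v *\<^sub>R v"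
  have ff: "pq_form f f = pq_form e e + (pq_form e v)\<^sup>2"
    using v pq_form_sym[of v e] by (simp add: f_def power2_eq_square)
  then have pos: "pq_form f f > 0"
    using \<open>pq_form e e > 0\<close> by (simp add: add_pos_nonneg)
  define u where "u = (1 / sqrt (pq_form f f)) *\<^sub>R f"
  have u: "pq_form u u = 1"
    using pos by (simp add: u_def field_simps)
  have vu: "pq_form v u = 0"
    using v pq_form_sym[of v e] by (simp add: u_def f_def)
  have "u \<in> V"
    using sV v \<open>e \<in> V\<close> by (simp add: u_def f_def subspace_add subspace_scale)
  have "u \<notin> span {v}"
    using u vu v(2) by (auto simp: span_singleton)
  moreover have "v \<noteq> 0" using v(2) by auto
  ultimately have "independent {u, v}"
    by (simp add: independent_insert)
  moreover have "u \<noteq> v" using u v(2) by auto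
  ultimately have "V \<subseteq> span {u, v}"
    using card_ge_dim_independent[of "{u, v}" V] sV v \<open>u \<in> V\<close> by simp
  with y have "y \<in> span {u, v}" by blast
  then obtain b where "y - b *\<^sub>R u \<in> span {v}"
    by (auto simp: span_breakdown_eq[of _ u])
  then obtain a where "y - b *\<^sub>R u = a *\<^sub>R v"
    by (auto simp: span_singleton)
  then have "y = a *\<^sub>R v + b *\<^sub>R u"
    by (simp add: algebra_simps)
  with u vu that show ?thesis by blast
qed

lemma pq_isometry_inverse:
  assumes "pq_isometry G" "det G = 1"
  obtains B where "G ** B = mat 1" "B ** G = mat 1" "pq_isometry B" "det B = 1"
proof -
  have "invertible G" using assms(2) by (simp add: invertible_det_nz)
  then obtain B where B: "G ** B = mat 1" "B ** G = mat 1"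
    by (auto simp: invertible_def)
  have "G *v (B *v x) = x" for x
    by (simp add: matrix_vector_mul_assoc B)
  then have "pq_isometry B"
    using assms(1) unfolding pq_isometry_def by metis
  moreover have "det B = 1"
    using det_mul[of G B] B assms(2) by simp
  ultimately show ?thesis using B that by blast
qed

lemma polar_decomposition_exists:
  fixes v w :: "real ^ ('p::finite + 'q::finite)"
  assumes v: "pq_form v v = - 1" and w: "pq_form w w = 1" and vw: "pq_form v w = 0"
    and d: "CARD('p) + CARD('q) > 2"
    and A: "det A = 1" "pq_isometry A"
    and C: "span {A *v v} \<in> C_spacelike (span {v})"
  obtains c H H' where "c \<ge> 0" "proj_class H \<in> stabilizer_pt (span {v})"
    "proj_class H' \<in> stabilizer_pt (span {v})" "A = H ** pq_boost v w c ** H'"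
proof -
  obtain V where V: "has_signature V 1 1" "span {v} \<subseteq> V" "span {A *v v} \<subseteq> V"
    using C by (auto simp: C_spacelike_def spacelike_geodesics_def)
  then have "v \<in> V" "A *v v \<in> V"
    using span_base by blast+
  then obtain u a b where u: "pq_form u u = 1" "pq_form v u = 0"
    and Av: "A *v v = a *\<^sub>R v + b *\<^sub>R u"
    using signature_1_1_coordinates[OF V(1) _ v] by metis
  have "pq_form (A *v v) (A *v v) = - 1"
    using A v by (simp add: pq_isometry_def)
  then have ab: "a\<^sup>2 = b\<^sup>2 + 1"
    using u v pq_form_sym[of u v] by (simp add: Av power2_eq_square)
  define c where "c = arsinh \<bar>b\<bar>"
  have c: "sinh c = \<bar>b\<bar>" "cosh c = \<bar>a\<bar>"
    by (simp_all add: c_def cosh_arsinh_real flip: ab)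
  have "c \<ge> 0" using c(1) by (metis abs_ge_zero sinh_real_nonneg_iff)
  \<comment> \<open>Passing from \<open>A *v v\<close> to its multiple by \<open>e\<close> makes the
    coefficient of \<open>v\<close> positive, as a hyperbolic cosine requires. The sign is absorbed
    by the right factor, which only has to preserve the line of \<open>v\<close>.\<close>
  define e where "e = sgn a"
  have "a \<noteq> 0" using ab by (metis add_nonneg_pos less_irrefl power_zero_numeral
        zero_le_power2 zero_less_one)
  then have e: "\<bar>e\<bar> = 1" "e * a = \<bar>a\<bar>" "e * e = 1"
    by (auto simp: e_def sgn_if)
  \<comment> \<open>The remaining sign goes into the direction \<open>u\<close>, so that the boost
    parameter stays nonnegative; the new direction is again unit and orthogonal to
    \<open>v\<close>.\<close>
  define r where "r = (if e * b \<ge> 0 then 1 else - 1 :: real)"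
  have r: "r * r = 1" "e * b = \<bar>b\<bar> * r"
    using e by (auto simp: r_def abs_if split: if_splits)
  have eAv: "e *\<^sub>R (A *v v) = cosh c *\<^sub>R v + sinh c *\<^sub>R (r *\<^sub>R u)"
    using e r by (simp add: Av c scaleR_add_right)
  obtain H where H: "det H = 1" "pq_isometry H" "H *v v = v" "H *v w = r *\<^sub>R u"
    using transitive_on_unit_spacelike[OF v w vw _ _ d, of "r *\<^sub>R u"] u r by auto
  define G where "G = H ** pq_boost v w c"
  have G: "pq_isometry G" "det G = 1"
    using H det_pq_boost[OF v w vw] pq_isometry_boost[OF v w vw]
    by (auto simp: G_def pq_isometry_mult det_mul)
  have Gv: "G *v v = e *\<^sub>R (A *v v)"
    unfolding eAv G_def using H by (simp add: pq_boost_v[OF v w vw] matrix_vector_right_distrib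
        matrix_vector_mult_scaleR flip: matrix_vector_mul_assoc)
  obtain B where B: "G ** B = mat 1" "B ** G = mat 1" "pq_isometry B" "det B = 1"
    by (rule pq_isometry_inverse[OF G])
  \<comment> \<open>\<open>e * e = 1\<close> lets \<open>e\<close> be inserted twice: the inner one
    turns the argument into \<open>G *v v\<close>, which \<open>B\<close> undoes, and the outer one
    is the eigenvalue of the right factor.\<close>
  have "(B ** A) *v v = e *\<^sub>R (B *v (e *\<^sub>R (A *v v)))"
    using e by (simp add: matrix_vector_mult_scaleR flip: matrix_vector_mul_assoc)
  also have "\<dots> = e *\<^sub>R v"
    using B(2) by (simp add: matrix_vector_mul_assoc flip: Gv)
  finally have "proj_class (B ** A) \<in> stabilizer_pt (span {v})"
    using A B e by (intro stabilizer_ptI[of _ _ e]) (auto simp: det_mul pq_isometry_mult)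
  moreover have "proj_class H \<in> stabilizer_pt (span {v})"
    using H by (intro stabilizer_ptI[of _ _ 1]) auto
  moreover have "A = H ** pq_boost v w c ** (B ** A)"
    using B(1) by (simp add: matrix_mul_assoc flip: G_def)
  ultimately show ?thesis using that \<open>c \<ge> 0\<close> by blast
qed

text \<open>The absolute value of <Av,v> is unchanged by stabilizer elements on either side and by
  the choice of representatives, all of which alter it only by signs; for the boost itself <Av,v> is
  -cosh c.\<close>

lemma polar_decomposition_cosh:
  assumes v: "pq_form v v = - 1" and w: "pq_form w w = 1" and vw: "pq_form v w = 0"
    and h: "h \<in> stabilizer_pt (span {v})" "h' \<in> stabilizer_pt (span {v})"
    and A: "pq_isometry A"
    and eq: "proj_class A = h \<otimes>\<^bsub>PSO\<^esub> proj_class (pq_boost v w c) \<otimes>\<^bsub>PSO\<^esub> h'"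
  shows "cosh c = \<bar>pq_form (A *v v) v\<bar>"
proof -
  obtain H e where H: "h = proj_class H" "pq_isometry H" "H *v v = e *\<^sub>R v" "\<bar>e\<bar> = 1"
    by (rule stabilizer_ptE[OF h(1) v])
  obtain H' e' where H': "h' = proj_class H'" "pq_isometry H'" "H' *v v = e' *\<^sub>R v" "\<bar>e'\<bar> = 1"
    by (rule stabilizer_ptE[OF h(2) v])
  define M where "M = H ** pq_boost v w c ** H'"
  have "proj_class A = proj_class M"
    by (simp add: eq H H' M_def proj_class_mult)
  moreover have "A \<in> proj_class A"
    unfolding proj_class_eq by (rule CollectI, rule exI[of _ 1]) simp
  \<comment> \<open>Representatives of one class differ by a scalar; both being isometries, the
    scalar is a sign.\<close>
  ultimately obtain k where k: "A = k *\<^sub>R M"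
    by (auto simp: proj_class_eq)
  have Mv: "M *v v = e' *\<^sub>R (H *v (pq_boost v w c *v v))"
    by (simp add: M_def H' matrix_vector_mult_scaleR flip: matrix_vector_mul_assoc)
  have M: "pq_isometry M"
    using H H' pq_isometry_boost[OF v w vw] by (simp add: M_def pq_isometry_mult)
  have "pq_form (A *v v) (A *v v) = k * k * pq_form (M *v v) (M *v v)"
    by (simp add: k flip: scaleR_matrix_vector_assoc)
  then have "k * k = 1"
    using A M v by (simp add: pq_isometry_def)
  then have k1: "\<bar>k\<bar> = 1" by (metis abs_square_eq_1 power2_eq_square)
  have wv: "pq_form w v = 0" using vw pq_form_sym[of w v] by simp
  have "e * pq_form (H *v (pq_boost v w c *v v)) v = pq_form (H *v (pq_boost v w c *v v)) (H *v v)"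
    using H by simp
  also have "\<dots> = pq_form (pq_boost v w c *v v) v"
    using H(2) unfolding pq_isometry_def by blast
  also have "\<dots> = - cosh c"
    using v wv by (simp add: pq_boost_v[OF v w vw])
  finally have "\<bar>e\<bar> * \<bar>pq_form (H *v (pq_boost v w c *v v)) v\<bar> = cosh c"
    by (simp flip: abs_mult)
  then show ?thesis
    using k1 H(4) H'(4) by (simp add: k Mv abs_mult flip: scaleR_matrix_vector_assoc)
qed

theorem proposition3p7:
  fixes pt \<tau> :: "(real ^ ('p::finite + 'q::finite)) set"
    and \<bb> \<bb>plus :: "(real ^ ('p + 'q) ^ ('p + 'q)) set"
    and g :: "(real ^ ('p + 'q) ^ ('p + 'q)) set"
  assumes "CARD('p) + CARD('q) > 2"
    and "pt \<in> Hpq"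
    and "\<tau> \<in> S_pt pt"
    and "maximal_subalgebra_in (p_part \<tau> \<inter> q_part pt) \<bb>"
    and "closed_weyl_chamber \<bb> \<bb>plus"
    and "g \<in> C_spacelike_G pt"
  shows "\<exists>!X. X \<in> \<bb>plus \<and>
    (\<exists>h\<in>stabilizer_pt pt. \<exists>h'\<in>stabilizer_pt pt.
       g = h \<otimes>\<^bsub>PSO\<^esub> proj_class (matrix_exp X) \<otimes>\<^bsub>PSO\<^esub> h')"
proof -
  obtain v where v: "pq_form v v = - 1" and pt: "pt = span {v}"
    by (rule Hpq_normalized[OF assms(2)])
  obtain X\<^sub>0 where X\<^sub>0: "X\<^sub>0 \<in> p_part \<tau> \<inter> q_part pt" "X\<^sub>0 \<noteq> 0"
    and \<bb>plus: "\<bb>plus = {t *\<^sub>R X\<^sub>0 | t. 0 \<le> t}"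
    using assms(4,5) by (auto simp: closed_weyl_chamber_def maximal_subalgebra_in_def)
  obtain s w where s: "s > 0" and w: "pq_form w w = 1" and vw: "pq_form v w = 0"
    and X\<^sub>0_apply: "\<And>x. X\<^sub>0 *v x = s *\<^sub>R (pq_form x w *\<^sub>R v - pq_form x v *\<^sub>R w)"
    using p_part_q_part_normal_form[OF v, of \<tau> X\<^sub>0] assms(3) X\<^sub>0 unfolding pt by metis
  have exp: "matrix_exp (t *\<^sub>R X\<^sub>0) = pq_boost v w (t * s)" for t
    by (rule matrix_exp_eq_pq_boost[OF v w vw])
      (simp add: X\<^sub>0_apply flip: scaleR_matrix_vector_assoc)
  obtain A where A: "g = proj_class A" "det A = 1" "pq_isometry A"
    "span {A *v v} \<in> C_spacelike (span {v})"
    using assms(6) by (auto simp: C_spacelike_G_def carrier_PSO pt proj_act_proj_class_span)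
  show ?thesis
  proof (rule ex_ex1I)
    obtain c H H' where c: "c \<ge> 0" and H: "proj_class H \<in> stabilizer_pt (span {v})"
      "proj_class H' \<in> stabilizer_pt (span {v})" and eq: "A = H ** pq_boost v w c ** H'"
      by (rule polar_decomposition_exists[OF v w vw assms(1) A(2-4)])
    \<comment> \<open>The generator of the chamber has boost speed \<open>s\<close>, so the
      parameter \<open>c\<close> is reached at \<open>c / s\<close>.\<close>
    have "g = proj_class H \<otimes>\<^bsub>PSO\<^esub> proj_class (matrix_exp ((c / s) *\<^sub>R X\<^sub>0)) \<otimes>\<^bsub>PSO\<^esub> proj_class H'"
      using s by (simp add: A(1) proj_class_mult exp flip: eq)
    moreover have "(c / s) *\<^sub>R X\<^sub>0 \<in> \<bb>plus"
      using c s by (auto simp: \<bb>plus)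
    ultimately show "\<exists>X. X \<in> \<bb>plus \<and> (\<exists>h\<in>stabilizer_pt pt. \<exists>h'\<in>stabilizer_pt pt.
        g = h \<otimes>\<^bsub>PSO\<^esub> proj_class (matrix_exp X) \<otimes>\<^bsub>PSO\<^esub> h')"
      using H unfolding pt by blast
  next
    have cosh: "\<exists>t\<ge>0. X = t *\<^sub>R X\<^sub>0 \<and> cosh (t * s) = \<bar>pq_form (A *v v) v\<bar>"
      if X: "X \<in> \<bb>plus \<and> (\<exists>h\<in>stabilizer_pt pt. \<exists>h'\<in>stabilizer_pt pt.
        g = h \<otimes>\<^bsub>PSO\<^esub> proj_class (matrix_exp X) \<otimes>\<^bsub>PSO\<^esub> h')" for X
    proof -
      obtain t where t: "t \<ge> 0" "X = t *\<^sub>R X\<^sub>0"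
        using X by (auto simp: \<bb>plus)
      then show ?thesis
        using X polar_decomposition_cosh[OF v w vw _ _ A(3), of _ _ "t * s"]
        unfolding pt A(1) by (auto simp: exp)
    qed
    fix X Y
    assume "X \<in> \<bb>plus \<and> (\<exists>h\<in>stabilizer_pt pt. \<exists>h'\<in>stabilizer_pt pt.
        g = h \<otimes>\<^bsub>PSO\<^esub> proj_class (matrix_exp X) \<otimes>\<^bsub>PSO\<^esub> h')"
      and "Y \<in> \<bb>plus \<and> (\<exists>h\<in>stabilizer_pt pt. \<exists>h'\<in>stabilizer_pt pt.
        g = h \<otimes>\<^bsub>PSO\<^esub> proj_class (matrix_exp Y) \<otimes>\<^bsub>PSO\<^esub> h')"
    from this[THEN cosh] obtain t t' where t: "t \<ge> 0" "X = t *\<^sub>R X\<^sub>0" "t' \<ge> 0" "Y = t' *\<^sub>R X\<^sub>0"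
      and "cosh (t * s) = \<bar>pq_form (A *v v) v\<bar>" "cosh (t' * s) = \<bar>pq_form (A *v v) v\<bar>"
      by blast
    \<comment> \<open>Both arguments are nonnegative, and there cosh is injective; this is where the
      half-line, rather than all of \<bb>, is essential.\<close>
    then have "t * s = t' * s"
      using s cosh_real_nonneg_le_iff[of "t * s" "t' * s"] cosh_real_nonneg_le_iff[of "t' * s" "t * s"]
      by simp
    then show "X = Y" using s t by simp
  qed
qed

end
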